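(* Let $t\ge 1$ be a real number, let $n\ge\lceil t\rceil+2$ be an integer, and let $\pi=(d_1\le d_2\le\dots\le d_n)$ be a graphical sequence. Suppose that for every integer $i$ with $t\le i<\dfrac{tn}{t+1}$ we have $$d_{\lfloor i/t\rfloor}\ge i+1\quad\text{or}\quad d_{n-i}\ge n-\lfloor i/t\rfloor .$$ Then $\pi$ is forcibly $t$-tough.
   Context: All graphs are finite and simple (no loops or multiple edges). A degree sequence of a graph is any sequence consisting of its vertex degrees; here sequences are written in nondecreasing order. A sequence $\pi$ of integers is graphical if it is a degree sequence of some graph $G$, and any such $G$ is called a realization of $\pi$. For a graph $G$, $\omega(G)$ denotes its number of connected components. For $t\ge 0$, $G$ is $t$-tough if $t\cdot\omega(G-X)\le|X|$ for every $X\subseteq V(G)$ with $\omega(G-X)>1$. A graphical sequence $\pi$ is forcibly $t$-tough if every realization of $\pi$ is $t$-tough. *)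

theory Defs
  imports Complex_Main "Graph_Theory.Graph_Theory"
begin

text \<open>
  Finite simple graphs are the \<open>pair_graph\<close>s of the library: finite, loopfree, symmetric digraphs
  whose arcs are pairs of vertices. An undirected edge \<open>uv\<close> is represented by the two arcs
  \<open>(u, v)\<close> and \<open>(v, u)\<close>, so the degree of a vertex is its out-degree, and the connected
  components are the strongly connected components.
\<close>

definition num_components :: "('a, 'b) pre_digraph \<Rightarrow> nat" where
  "num_components G = card (pre_digraph.sccs G)"

definition tough :: "real \<Rightarrow> 'a pair_pre_digraph \<Rightarrow> bool" where
  "tough t G \<longleftrightarrow>
    (\<forall>X \<subseteq> pverts G. num_components (with_proj G \<restriction> (pverts G - X)) > 1 \<longrightarrow>
       t * real (num_components (with_proj G \<restriction> (pverts G - X))) \<le> real (card X))"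

text \<open>
  A sequence \<open>d\<^sub>1, \<dots>, d\<^sub>n\<close> is a function together with its length \<open>n\<close>; values outside
  \<open>{1..n}\<close> are irrelevant.
\<close>

definition realization :: "nat \<Rightarrow> (nat \<Rightarrow> int) \<Rightarrow> 'a pair_pre_digraph \<Rightarrow> bool" where
  "realization n d G \<longleftrightarrow> pair_graph G \<and>
    (\<exists>v. bij_betw v {1..n} (pverts G) \<and>
         (\<forall>k \<in> {1..n}. int (out_degree (with_proj G) (v k)) = d k))"

text \<open>
  Every finite graph is isomorphic to one whose vertices are natural numbers, so restricting the
  existential quantifier to such graphs loses nothing.
\<close>

definition graphical :: "nat \<Rightarrow> (nat \<Rightarrow> int) \<Rightarrow> bool" where
  "graphical n d \<longleftrightarrow> (\<exists>G :: nat pair_pre_digraph. realization n d G)"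

text \<open>
  The first argument fixes the type of the vertices of the realizations considered; it is meant to
  be left arbitrary.
\<close>

definition forcibly_tough :: "'a itself \<Rightarrow> real \<Rightarrow> nat \<Rightarrow> (nat \<Rightarrow> int) \<Rightarrow> bool" where
  "forcibly_tough _ t n d \<longleftrightarrow> (\<forall>G :: 'a pair_pre_digraph. realization n d G \<longrightarrow> tough t G)"

end

theory Submission
  imports Defs
begin

text \<open>
  Suppose a realization \<open>G\<close> of the sequence is not \<open>t\<close>-tough: removing some set \<open>X\<close> of \<open>x\<close>
  vertices leaves \<open>k \<ge> 2\<close> components with \<open>x < t * k\<close>. A vertex outside \<open>X\<close> has all its
  neighbours in \<open>X\<close> and in its own component. Single out a largest component \<open>L\<close>, let \<open>c\<close> be the
  largest size of the others and \<open>m\<close> the number of their vertices. Then \<open>G\<close> has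
  \<^item> \<open>m\<close> vertices (those outside \<open>X\<close> and \<open>L\<close>) of degree at most \<open>x + c - 1\<close>, and
  \<^item> \<open>n - x\<close> vertices (those outside \<open>X\<close>) of degree at most \<open>x + card L - 1 = n - m - 1\<close>.

  So \<open>d\<^sub>j \<le> x + c - 1\<close> for all \<open>j \<le> m\<close>, and \<open>d\<^sub>j \<le> n - m - 1\<close> for all \<open>j \<le> n - x\<close>. Since the
  \<open>k - 1\<close> components other than \<open>L\<close> are nonempty and one of them has \<open>c\<close> vertices,
  \<open>m \<ge> c + k - 2\<close>.

  The hypothesis fails at \<open>i = x + c - 1\<close>, provided that \<open>i \<ge> t\<close>. Indeed
  \<open>i < t * k + (c - 1) \<le> t * (k + c - 1)\<close> because \<open>t \<ge> 1\<close>, so that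
  \<open>\<lfloor>i / t\<rfloor> \<le> k + c - 2 \<le> m\<close>; hence the entry with index \<open>\<lfloor>i / t\<rfloor>\<close> is at most \<open>i\<close>. As
  \<open>n - i \<le> n - x\<close>, the entry with index \<open>n - i\<close> is at most \<open>n - m - 1 < n - \<lfloor>i / t\<rfloor>\<close>. Finally
  \<open>n - i = m + card L - c + 1 \<ge> k + c - 1 > i / t\<close>, which says that \<open>i < t * n / (t + 1)\<close>. If
  \<open>x + c - 1 < t\<close>, then \<open>i = \<lceil>t\<rceil>\<close> does the same job, with \<open>\<lfloor>i / t\<rfloor> = 1\<close>; the lower bound on
  \<open>n\<close> puts this \<open>i\<close> in the admissible range.
\<close>

section \<open>Combinatorial ingredients\<close>

lemma mono_on_le_of_card:
  fixes d :: "nat \<Rightarrow> int"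
  assumes mono: "mono_on {1..n} d" and I: "I \<subseteq> {1..n}"
    and le: "\<And>k. k \<in> I \<Longrightarrow> d k \<le> b" and j: "1 \<le> j" "j \<le> card I"
  shows "d j \<le> b"
proof -
  have "\<exists>k\<in>I. j \<le> k"
  proof (rule ccontr)
    assume "\<not> ?thesis"
    hence "I \<subseteq> {1..<j}" using I by force
    from card_mono[OF _ this] j show False by simp
  qed
  then obtain k where k: "k \<in> I" "j \<le> k" by blast
  have "d j \<le> d k" using mono k I j by (intro mono_onD[OF mono]) auto
  with le[OF k(1)] show ?thesis by simp
qed

lemma realization_le_of_card:
  assumes real: "realization n d G" and mono: "mono_on {1..n} d" and A: "A \<subseteq> pverts G"
    and deg: "\<And>u. u \<in> A \<Longrightarrow> int (out_degree (with_proj G) u) \<le> b"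
    and j: "1 \<le> j" "j \<le> card A"
  shows "d j \<le> b"
proof -
  obtain v where v: "bij_betw v {1..n} (pverts G)"
    and dv: "\<And>k. k \<in> {1..n} \<Longrightarrow> int (out_degree (with_proj G) (v k)) = d k"
    using real unfolding realization_def by blast
  define I where "I = {k \<in> {1..n}. v k \<in> A}"
  have "A \<subseteq> v ` {1..n}" using A v by (simp add: bij_betw_def)
  hence "v ` I = A" unfolding I_def by blast
  hence "card A \<le> card I" using card_image_le[of I v] by (auto simp: I_def)
  show ?thesis
  proof (rule mono_on_le_of_card[OF mono])
    show "I \<subseteq> {1..n}" by (auto simp: I_def)
    show "j \<le> card I" using j(2) \<open>card A \<le> card I\<close> by (rule order_trans)
    show "1 \<le> j" by (rule j(1))
    fix k assume "k \<in> I"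
    thus "d k \<le> b" using dv[of k] deg[of "v k"] by (simp add: I_def)
  qed
qed

text \<open>
  A neighbour of \<open>u\<close> outside \<open>X\<close> is reachable from \<open>u\<close> without meeting \<open>X\<close>, in both directions
  because the graph is symmetric, and so belongs to the component of \<open>u\<close>. The summand \<open>1\<close> accounts
  for \<open>u\<close> itself, which is in \<open>C\<close> but is not its own neighbour.
\<close>

lemma (in pair_graph) out_degree_component_bound:
  assumes X: "X \<subseteq> pverts G" and u: "u \<in> C"
    and C: "C \<in> pre_digraph.sccs_verts (with_proj G \<restriction> (pverts G - X))"
  shows "out_degree (with_proj G) u + 1 \<le> card X + card C"
proof -
  let ?H = "with_proj G \<restriction> (pverts G - X)"
  interpret H: wf_digraph ?H by (rule wellformed_induce_subgraph)
  have CV: "C \<subseteq> pverts G - X" using H.sccs_verts_subsets[OF C] by simp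
  have fin: "finite X" "finite C"
    using X CV pair_finite_verts by (auto intro: finite_subset)
  have arc: "a \<in> Pair u ` (X \<union> (C - {u}))"
    if "a \<in> out_arcs (with_proj G) u" for a
  proof -
    obtain w where a: "a = (u, w)" and uw: "(u, w) \<in> parcs G"
      using \<open>a \<in> out_arcs _ u\<close> by (cases a) auto
    have wu: "(w, u) \<in> parcs G" using uw arcs_symmetric by blast
    have "w \<noteq> u" using uw no_loops' by blast
    moreover have "w \<in> C" if "w \<notin> X"
    proof (rule ccontr)
      assume "w \<notin> C"
      have "(u, w) \<in> arcs ?H" "(w, u) \<in> arcs ?H"
        using uw wu u CV \<open>w \<notin> X\<close> in_arcsD2 by auto
      hence "u \<rightarrow>\<^bsub>?H\<^esub> w" "w \<rightarrow>\<^bsub>?H\<^esub> u"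
        by (auto simp: arcs_ends_conv intro: rev_image_eqI)
      hence "u \<rightarrow>\<^sup>*\<^bsub>?H\<^esub> w" "w \<rightarrow>\<^sup>*\<^bsub>?H\<^esub> u"
        by (auto intro: H.reachable_adjI)
      thus False
        using C u \<open>w \<notin> C\<close> by (auto simp: H.in_sccs_verts_conv_reachable)
    qed
    ultimately show ?thesis using a by blast
  qed
  have "out_degree (with_proj G) u \<le> card (Pair u ` (X \<union> (C - {u})))"
    unfolding out_degree_def using arc fin by (intro card_mono) auto
  also have "\<dots> \<le> card (X \<union> (C - {u}))" using fin by (intro card_image_le) auto
  also have "\<dots> \<le> card X + card (C - {u})" by (rule card_Un_le)
  finally have "out_degree (with_proj G) u \<le> card X + (card C - 1)"
    using u by simp
  moreover have "0 < card C" using u fin by (auto simp: card_gt_0_iff)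
  ultimately show ?thesis by linarith
qed

text \<open>
  Among the blocks other than \<open>L\<close>, one has \<open>c\<close> elements and each of the \<open>card P - 2\<close> remaining ones
  has at least one; this is the bound on the size of their union.
\<close>

lemma two_largest_blocks:
  assumes fin: "finite (\<Union>P)" and ne: "{} \<notin> P" and disj: "pairwise disjnt P"
    and P: "2 \<le> card P"
  obtains L c where "L \<in> P" "1 \<le> c" "c \<le> card L" "\<And>B. B \<in> P \<Longrightarrow> card B \<le> card L"
    "\<And>B. B \<in> P - {L} \<Longrightarrow> card B \<le> c" "card P + c \<le> card (\<Union>(P - {L})) + 2"
proof -
  have finB: "finite B" if "B \<in> P" for B
    using that by (intro finite_subset[OF _ fin]) auto
  have "finite P" using fin by (rule finite_UnionD)
  have "P \<noteq> {}" using P by auto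
  obtain L where L: "L \<in> P" "\<And>B. B \<in> P \<Longrightarrow> card B \<le> card L"
    using Max_in[of "card ` P"] Max_ge[of "card ` P"] \<open>finite P\<close> \<open>P \<noteq> {}\<close> by fastforce
  define Q where "Q = P - {L}"
  have cQ: "card Q = card P - 1" using L \<open>finite P\<close> by (simp add: Q_def)
  have finQ: "finite Q" using \<open>finite P\<close> by (simp add: Q_def)
  have "Q \<noteq> {}" using cQ P by auto
  then obtain M where M: "M \<in> Q" "\<And>B. B \<in> Q \<Longrightarrow> card B \<le> card M"
    using Max_in[of "card ` Q"] Max_ge[of "card ` Q"] finQ by fastforce
  have one: "1 \<le> card B" if "B \<in> P" for B
    using that ne finB[OF that] by (metis One_nat_def Suc_leI card_gt_0_iff)
  have "card (\<Union>Q) = (\<Sum>B\<in>Q. card B)"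
    using disj finB by (intro card_Union_disjoint) (auto simp: Q_def pairwise_def)
  also have "\<dots> = card M + (\<Sum>B\<in>Q - {M}. card B)"
    using finQ M(1) by (rule sum.remove)
  finally have "card (\<Union>Q) = card M + (\<Sum>B\<in>Q - {M}. card B)" .
  moreover have "(\<Sum>B\<in>Q - {M}. 1) \<le> (\<Sum>B\<in>Q - {M}. card B)"
    using one by (intro sum_mono) (auto simp: Q_def)
  moreover have "(\<Sum>B\<in>Q - {M}. 1) = card Q - 1" using M(1) finQ by simp
  ultimately have "card P + card M \<le> card (\<Union>Q) + 2"
    using cQ P by linarith
  thus ?thesis
    using that[of L "card M"] L M one[of M] by (auto simp: Q_def)
qed

section \<open>The index at which the degree condition fails\<close>

text \<open>
  The numbers stand for the parameters of a set whose removal violates toughness: \<open>x\<close> is its size,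
  \<open>k\<close> the number of components left, \<open>l\<close> and \<open>c\<close> the sizes of the two largest ones, and \<open>m\<close> the
  number of vertices in all of them but the largest. Taking the larger of the two candidates
  \<open>x + c - 1\<close> and \<open>\<lceil>t\<rceil>\<close> for \<open>i\<close> makes \<open>i \<ge> t\<close> hold in any case.
\<close>

lemma index_of_failure:
  fixes t :: real and n x k c m l :: nat
  assumes t: "1 \<le> t" and n: "\<lceil>t\<rceil> + 2 \<le> int n" and sum: "n = x + m + l"
    and x: "real x < t * real k" and c: "1 \<le> c" "c \<le> l" and k: "2 \<le> k"
    and m: "k + c \<le> m + 2"
  obtains i :: int where "t \<le> real_of_int i" "real_of_int i < t * real n / (t + 1)"
    "int x + int c - 1 \<le> i" "1 \<le> \<lfloor>real_of_int i / t\<rfloor>" "\<lfloor>real_of_int i / t\<rfloor> \<le> int m"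
    "1 \<le> int n - i" "int n - i \<le> int n - int x"
proof -
  define i where "i = max (int x + int c - 1) \<lceil>t\<rceil>"
  have ti: "t \<le> real_of_int i" unfolding i_def by linarith
  have "real_of_int i / t < real_of_int (int m + 1) \<and> real_of_int i / t < real_of_int (int n - i)"
  proof (cases "\<lceil>t\<rceil> \<le> int x + int c - 1")
    case True
    hence i: "i = int x + int c - 1" by (simp add: i_def)
    have "real c - 1 \<le> t * (real c - 1)" using t c by (simp add: mult_le_cancel_right1)
    hence "real_of_int i < t * (real k + real c - 1)"
      using x by (simp add: i algebra_simps)
    hence "real_of_int i / t < real k + real c - 1"
      using t by (simp add: divide_less_eq mult.commute)
    moreover have "real k + real c - 1 \<le> real_of_int (int m + 1)" using m by simp
    moreover have "real_of_int (int m + 1) \<le> real_of_int (int n - i)"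
      unfolding of_int_le_iff using i sum c by linarith
    ultimately show ?thesis by linarith
  next
    case False
    hence i: "i = \<lceil>t\<rceil>" by (simp add: i_def)
    have "real_of_int i < t + 1" unfolding i by linarith
    hence "real_of_int i / t < 2" using t by (simp add: divide_less_eq)
    moreover have "2 \<le> int m + 1" "2 \<le> int n - i" using i n m k c by linarith+
    ultimately show ?thesis by linarith
  qed
  hence im: "real_of_int i / t < real_of_int (int m + 1)"
    and ini: "real_of_int i / t < real_of_int (int n - i)" by auto
  have "1 \<le> real_of_int i / t" using ti t by simp
  hence floor1: "1 \<le> \<lfloor>real_of_int i / t\<rfloor>" by linarith
  have range: "real_of_int i < t * real n / (t + 1)"
    using ini t by (simp add: field_simps)
  show ?thesis
  proof (rule that[OF ti range _ floor1])
    show "int x + int c - 1 \<le> i" by (simp add: i_def)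
    show "\<lfloor>real_of_int i / t\<rfloor> \<le> int m" using im by linarith
    show "1 \<le> int n - i" using \<open>1 \<le> real_of_int i / t\<close> ini by linarith
    show "int n - i \<le> int n - int x" using c by (simp add: i_def)
  qed
qed

section \<open>The degree condition forces toughness\<close>

theorem theorem2p1:
  fixes t :: real and n :: nat and d :: "nat \<Rightarrow> int"
  assumes "t \<ge> 1"
    and "int n \<ge> \<lceil>t\<rceil> + 2"
    and "mono_on {1..n} d"
    and "graphical n d"
    and "\<And>i :: int. t \<le> real_of_int i \<Longrightarrow> real_of_int i < t * real n / (t + 1) \<Longrightarrow>
           d (nat \<lfloor>real_of_int i / t\<rfloor>) \<ge> i + 1 \<or>
           d (nat (int n - i)) \<ge> int n - \<lfloor>real_of_int i / t\<rfloor>"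
  shows "forcibly_tough TYPE('a) t n d"
  unfolding forcibly_tough_def tough_def
proof (intro allI impI)
  fix G :: "'a pair_pre_digraph" and X
  assume real: "realization n d G" and X: "X \<subseteq> pverts G"
    and two: "1 < num_components (with_proj G \<restriction> (pverts G - X))"
  let ?H = "with_proj G \<restriction> (pverts G - X)"
  show "t * real (num_components ?H) \<le> real (card X)"
  proof (rule ccontr)
    assume not_tough: "\<not> ?thesis"
    interpret pair_graph G using real by (simp add: realization_def)
    interpret H: wf_digraph ?H by (rule wellformed_induce_subgraph)
    define P where "P = H.sccs_verts"
    have k: "num_components ?H = card P"
      by (simp add: num_components_def P_def H.card_sccs_verts)
    have UP: "\<Union>P = pverts G - X"
    proof (intro equalityI subsetI)
      fix u assume "u \<in> \<Union>P"
      then obtain B where "B \<in> H.sccs_verts" "u \<in> B" by (auto simp: P_def)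
      thus "u \<in> pverts G - X" using H.sccs_verts_subsets[of B] by auto
    next
      fix u assume u: "u \<in> pverts G - X"
      have "H.scc_of u \<in> P" "u \<in> H.scc_of u"
        using u H.scc_of_in_sccs_verts[of u] H.in_scc_of_self[of u] by (simp_all add: P_def)
      thus "u \<in> \<Union>P" by (rule UnionI)
    qed
    have finU: "finite (\<Union>P)" using UP pair_finite_verts by simp
    have disj: "pairwise disjnt P"
      using H.sccs_verts_disjoint by (auto simp: P_def pairwise_def disjnt_def)
    have ne: "{} \<notin> P" by (simp add: P_def H.in_sccs_verts_conv_reachable)
    have two_le: "2 \<le> card P" using two k by simp
    obtain L c where L: "L \<in> P" and c: "1 \<le> c" "c \<le> card L"
      and leL: "\<And>B. B \<in> P \<Longrightarrow> card B \<le> card L"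
      and lec: "\<And>B. B \<in> P - {L} \<Longrightarrow> card B \<le> c"
      and cm: "card P + c \<le> card (\<Union>(P - {L})) + 2"
      using two_largest_blocks[OF finU ne disj two_le] by metis
    define m where "m = card (\<Union>(P - {L}))"
    have split: "\<Union>P = \<Union>(P - {L}) \<union> L" using L by blast
    have "\<Union>(P - {L}) \<inter> L = {}"
      using disj L by (auto simp: pairwise_def disjnt_def)
    hence cardU: "card (\<Union>P) = m + card L"
      using finU unfolding m_def split by (intro card_Un_disjoint) auto
    have "card (pverts G) = n"
      using real by (auto simp: realization_def dest!: bij_betw_same_card)
    hence sum: "n = card X + m + card L"
      using cardU card_Diff_subset[of X "pverts G"] card_mono[OF pair_finite_verts X]
        finite_subset[OF X pair_finite_verts] X UP by simp
    have deg: "int (out_degree (with_proj G) u) \<le> int (card X) + int (card B) - 1"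
      if "B \<in> P" "u \<in> B" for B u
      using out_degree_component_bound[OF X that(2) that(1)[unfolded P_def]] by linarith
    have low: "d j \<le> int (card X) + int c - 1" if "1 \<le> j" "j \<le> m" for j
    proof (rule realization_le_of_card[OF real \<open>mono_on {1..n} d\<close> _ _ that(1)])
      show "\<Union>(P - {L}) \<subseteq> pverts G" using UP by blast
      show "j \<le> card (\<Union>(P - {L}))" using that(2) by (simp add: m_def)
      fix u assume "u \<in> \<Union>(P - {L})"
      then obtain B where "B \<in> P - {L}" "u \<in> B" by blast
      thus "int (out_degree (with_proj G) u) \<le> int (card X) + int c - 1"
        using deg[of B u] lec[of B] by simp
    qed
    have high: "d j \<le> int n - int m - 1" if "1 \<le> j" "j \<le> n - card X" for j
    proof (rule realization_le_of_card[OF real \<open>mono_on {1..n} d\<close> _ _ that(1)])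
      show "\<Union>P \<subseteq> pverts G" using UP by blast
      show "j \<le> card (\<Union>P)" using that(2) cardU sum by simp
      fix u assume "u \<in> \<Union>P"
      then obtain B where "B \<in> P" "u \<in> B" by blast
      thus "int (out_degree (with_proj G) u) \<le> int n - int m - 1"
        using deg[of B u] leL[of B] sum by simp
    qed
    obtain i :: int where i: "t \<le> real_of_int i" "real_of_int i < t * real n / (t + 1)"
      and xc: "int (card X) + int c - 1 \<le> i"
      and j: "1 \<le> \<lfloor>real_of_int i / t\<rfloor>" "\<lfloor>real_of_int i / t\<rfloor> \<le> int m"
      and ni: "1 \<le> int n - i" "int n - i \<le> int n - int (card X)"
      by (rule index_of_failure[OF \<open>t \<ge> 1\<close> \<open>int n \<ge> \<lceil>t\<rceil> + 2\<close> sum _ c _ cm[folded m_def]])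
        (use not_tough two k in auto)
    have "d (nat \<lfloor>real_of_int i / t\<rfloor>) \<le> int (card X) + int c - 1"
      using j by (intro low) linarith+
    moreover have "d (nat (int n - i)) \<le> int n - int m - 1"
      using ni by (intro high) linarith+
    ultimately show False using assms(5)[OF i] xc j by linarith
  qed
qed

end
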